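(* Let $G$ be a connected graph with $n$ vertices and $m$ edges. Then $$BH(G)\leq \frac{n(n-1)^2}{4(2m+M_1(G))}\left(4+\left(r_L(G)-\frac{1}{r_L(G)}\right)^{2}\right).$$
   Context: For a graph $G$ on $n$ vertices, $L(G)=D(G)-A(G)$ is its Laplacian matrix with eigenvalues $0=\lambda_1\le\lambda_2\le\cdots\le\lambda_n$; for connected $G$ with $n\ge2$, $\lambda_2>0$. The biharmonic index is $BH(G)=\frac12\sum_{u,v\in V(G)}d_B^2(u,v)$ with $d_B^2$ the squared biharmonic distance; equivalently $BH(G)=n\sum_{i=2}^n \lambda_i^{-2}$. $M_1(G)=\sum_{v}d(v)^2$ is the first Zagreb index, and $r_L(G)=\lambda_n/\lambda_2$ is the Laplacian spectral ratio. *)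

theory Defs
  imports
    "HOL-Analysis.Analysis"
    "HOL-Computational_Algebra.Polynomial"
    "Graph_Theory.Digraph_Component"
begin

text \<open>
  A finite simple graph is a \<^locale>\<open>graph\<close>: a finite symmetric digraph without loops and
  without multiple arcs, in which an undirected edge is represented by two opposite arcs. So the
  degree of a vertex is its out-degree, and edges are counted as unordered pairs of endpoints.
  Matrices indexed by the vertices have type \<open>real^'v^'v\<close>; they are used for graphs whose vertex
  set is the whole of the finite type \<open>'v\<close>.
\<close>

definition edge_set :: "('v, 'e) pre_digraph \<Rightarrow> 'v set set" where
  "edge_set G = (\<lambda>e. {tail G e, head G e}) ` arcs G"

definition degree_matrix :: "('v::finite, 'e) pre_digraph \<Rightarrow> real^'v^'v" where
  "degree_matrix G = (\<chi> u v. if u = v then real (out_degree G u) else 0)"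

definition adjacency_matrix :: "('v::finite, 'e) pre_digraph \<Rightarrow> real^'v^'v" where
  "adjacency_matrix G = (\<chi> u v. if u \<rightarrow>\<^bsub>G\<^esub> v then 1 else 0)"

definition laplacian :: "('v::finite, 'e) pre_digraph \<Rightarrow> real^'v^'v" where
  "laplacian G = degree_matrix G - adjacency_matrix G"

definition charpoly :: "real^'n^'n \<Rightarrow> real poly" where
  "charpoly A = det (\<chi> i j. (if i = j then [:0, 1:] else 0) - [:A $ i $ j:])"

text \<open>
  The real eigenvalues in increasing order, repeated according to their algebraic multiplicity.
  For a symmetric matrix the list has as many entries as the matrix has rows.
\<close>

definition eigenvalue_list :: "real^'n^'n \<Rightarrow> real list" where
  "eigenvalue_list A = sorted_list_of_multiset (proots (charpoly A))"

text \<open>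
  \<open>laplacian_eigenvalue G i\<close> is $\lambda_i$, numbered from 1; it is meaningful only for
  $1 \le i \le n$.
\<close>

definition laplacian_eigenvalue :: "('v::finite, 'e) pre_digraph \<Rightarrow> nat \<Rightarrow> real" where
  "laplacian_eigenvalue G i = eigenvalue_list (laplacian G) ! (i - 1)"

text \<open>
  On a single vertex there is no $\lambda_2$, and the ratio is an unspecified number.
\<close>

definition laplacian_spectral_ratio :: "('v::finite, 'e) pre_digraph \<Rightarrow> real" where
  "laplacian_spectral_ratio G =
     laplacian_eigenvalue G (card (verts G)) / laplacian_eigenvalue G 2"

definition is_moore_penrose_inverse :: "real^'n^'m \<Rightarrow> real^'m^'n \<Rightarrow> bool" where
  "is_moore_penrose_inverse A X \<longleftrightarrow>
     A ** X ** A = A \<and> X ** A ** X = X \<and>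
     transpose (A ** X) = A ** X \<and> transpose (X ** A) = X ** A"

definition moore_penrose_inverse :: "real^'n^'m \<Rightarrow> real^'m^'n" where
  "moore_penrose_inverse A = (THE X. is_moore_penrose_inverse A X)"

text \<open>
  The squared biharmonic distance is $(e_u - e_v)^T (L^+)^2 (e_u - e_v)$, written out in entries.
\<close>

definition biharmonic_dist_sq :: "('v::finite, 'e) pre_digraph \<Rightarrow> 'v \<Rightarrow> 'v \<Rightarrow> real" where
  "biharmonic_dist_sq G u v =
     (let B = moore_penrose_inverse (laplacian G) ** moore_penrose_inverse (laplacian G)
      in B $ u $ u + B $ v $ v - 2 * B $ u $ v)"

definition biharmonic_index :: "('v::finite, 'e) pre_digraph \<Rightarrow> real" where
  "biharmonic_index G = (\<Sum>u\<in>verts G. \<Sum>v\<in>verts G. biharmonic_dist_sq G u v) / 2"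

definition first_zagreb_index :: "('v, 'e) pre_digraph \<Rightarrow> nat" where
  "first_zagreb_index G = (\<Sum>v\<in>verts G. (out_degree G v)\<^sup>2)"

end

theory Submission
  imports Defs
begin

text \<open>
  Write \<open>L = Q D Q\<^sup>T\<close> with \<open>Q\<close> orthogonal and \<open>D\<close> diagonal. Then \<open>L\<^sup>+ = Q D\<^sup>+ Q\<^sup>T\<close>, and as
  \<open>L\<^sup>+\<close> annihilates the constant vectors, $BH(G) = n \,\mathrm{tr}\,(L^+)^2 = n \sum_{i \ge 2}
  \lambda_i^{-2}$. Moreover $\sum_{i \ge 2} \lambda_i^2 = \mathrm{tr}\,L^2 = 2m + M_1(G)$. Kantorovich's
  inequality for the numbers $\lambda_2^2, \dots, \lambda_n^2$ bounds the product of the two sums by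
  $\frac{(n-1)^2}{4} (r_L + 1/r_L)^2$, and $(r + 1/r)^2 = 4 + (r - 1/r)^2$.
\<close>

section \<open>The spectral theorem for real symmetric matrices\<close>

lemma symmetric_inner_commute:
  fixes A :: "real^'n^'n"
  assumes "transpose A = A"
  shows "x \<bullet> (A *v y) = (A *v x) \<bullet> y"
  using assms by (metis dot_lmul_matrix vector_transpose_matrix)

text \<open>The eigenvector is a maximiser of the Rayleigh quotient on the invariant subspace.\<close>

lemma symmetric_eigenvector_exists:
  fixes A :: "real^'n^'n"
  assumes sym: "transpose A = A" and S: "subspace S" and "S \<noteq> {0}"
    and inv: "\<And>x. x \<in> S \<Longrightarrow> A *v x \<in> S"
  obtains v c where "v \<in> S" "norm v = 1" "A *v v = c *\<^sub>R v"
proof -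
  obtain w where w: "w \<in> S" "w \<noteq> 0"
    using assms subspace_0 by blast
  have "compact (S \<inter> sphere 0 1)"
    using S by (intro closed_Int_compact closed_subspace) auto
  moreover have "w /\<^sub>R norm w \<in> S \<inter> sphere 0 1"
    using w S by (auto simp: subspace_scale)
  moreover have "continuous_on (S \<inter> sphere 0 1) (\<lambda>x. x \<bullet> (A *v x))"
    by (intro continuous_on_inner continuous_on_id linear_continuous_on
        matrix_vector_mul_bounded_linear)
  ultimately obtain v where v: "v \<in> S \<inter> sphere 0 1"
    and vmax: "\<And>x. x \<in> S \<inter> sphere 0 1 \<Longrightarrow> x \<bullet> (A *v x) \<le> v \<bullet> (A *v v)"
    using continuous_attains_sup by (metis (no_types, lifting) empty_iff)
  define \<mu> where "\<mu> = v \<bullet> (A *v v)"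
  have vS: "v \<in> S" and vn: "norm v = 1" using v by auto
  have vv: "v \<bullet> v = 1" using vn by (simp add: norm_eq_1)
  \<comment> \<open>Both sides are homogeneous of degree 2, so the maximum over the unit sphere of
    \<open>S\<close> bounds the form on all of \<open>S\<close>.\<close>
  have bound: "x \<bullet> (A *v x) \<le> \<mu> * (x \<bullet> x)" if "x \<in> S" for x
  proof (cases "x = 0")
    case False
    have "x /\<^sub>R norm x \<in> S \<inter> sphere 0 1"
      using that False S by (auto simp: subspace_scale)
    from vmax[OF this] have "(x \<bullet> (A *v x)) / (norm x)\<^sup>2 \<le> \<mu>"
      by (simp add: \<mu>_def matrix_vector_mult_scaleR power2_eq_square field_simps)
    then show ?thesis
      using False by (simp add: divide_le_eq power2_norm_eq_inner)
  qed simp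
  \<comment> \<open>The residual \<open>r\<close> is the component of \<open>A *v v\<close>
    orthogonal to \<open>v\<close>. It vanishes exactly when \<open>v\<close> is an
    eigenvector.\<close>
  define r where "r = A *v v - \<mu> *\<^sub>R v"
  have rS: "r \<in> S" unfolding r_def using S inv vS by (simp add: subspace_diff subspace_scale)
  have rv: "r \<bullet> v = 0"
    using vv inner_commute[of v "A *v v"] by (simp add: r_def inner_diff_left \<mu>_def)
  have rA: "r \<bullet> (A *v v) = r \<bullet> r"
  proof -
    have "A *v v = r + \<mu> *\<^sub>R v" by (simp add: r_def)
    then show ?thesis by (simp add: inner_add_right rv)
  qed
  have vr: "v \<bullet> (A *v r) = r \<bullet> r"
    using symmetric_inner_commute[OF sym] rA by (metis inner_commute)
  \<comment> \<open>Perturb the maximiser to \<open>v + t *\<^sub>R r\<close>: the constant terms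
    cancel and the first-order term \<open>2 * t * (r \<bullet> r)\<close> is bounded by a
    second-order one, which forces \<open>r = 0\<close>.\<close>
  have key: "2 * t * (r \<bullet> r) \<le> t\<^sup>2 * (\<mu> * (r \<bullet> r) - r \<bullet> (A *v r))" for t
  proof -
    have "v + t *\<^sub>R r \<in> S" using S vS rS by (simp add: subspace_add subspace_scale)
    from bound[OF this] show ?thesis
      using rv rA vr vv \<mu>_def
      by (simp add: matrix_vector_right_distrib matrix_vector_mult_scaleR inner_add_left
          inner_add_right inner_commute[of v r] algebra_simps power2_eq_square)
  qed
  define K where "K = \<mu> * (r \<bullet> r) - r \<bullet> (A *v r)"
  have "r \<bullet> r = 0"
  proof (cases "K = 0")
    case True
    then have "r \<bullet> r \<le> 0" using key[of 1] by (simp add: K_def)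
    then show ?thesis by (simp only: antisym inner_ge_zero)
  next
    case False
    then have "K > 0" using bound[OF rS] by (simp add: K_def)
    \<comment> \<open>The parameter \<open>(r \<bullet> r) / K\<close> minimises
      \<open>t\<^sup>2 * K - 2 * t * (r \<bullet> r)\<close>.\<close>
    have "2 * (r \<bullet> r)\<^sup>2 / K \<le> (r \<bullet> r)\<^sup>2 / K"
      using key[of "(r \<bullet> r) / K", folded K_def] \<open>K > 0\<close> by (simp add: power2_eq_square)
    then have "(r \<bullet> r)\<^sup>2 \<le> 0" using \<open>K > 0\<close> by (simp add: field_simps)
    then show ?thesis by simp
  qed
  then have "A *v v = \<mu> *\<^sub>R v" by (simp add: r_def)
  with vS vn show thesis by (rule that)
qed

text \<open>Deflation: the orthogonal complement of the eigenvectors found so far is invariant under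
  \<open>A\<close>, and nonzero while there are fewer than \<open>CARD('n)\<close> of them, so it
  contains a further one.\<close>

lemma symmetric_orthonormal_eigenvectors:
  fixes A :: "real^'n^'n"
  assumes sym: "transpose A = A" and "k \<le> CARD('n)"
  shows "\<exists>B. finite B \<and> card B = k \<and> pairwise orthogonal B \<and>
    (\<forall>b\<in>B. norm b = 1 \<and> (\<exists>c. A *v b = c *\<^sub>R b))"
  using assms(2)
proof (induction k)
  case 0
  show ?case by (intro exI[of _ "{}"]) simp
next
  case (Suc k)
  then obtain B where B: "finite B" "card B = k" "pairwise orthogonal B"
    and ev: "\<And>b. b \<in> B \<Longrightarrow> norm b = 1 \<and> (\<exists>c. A *v b = c *\<^sub>R b)"
    by auto
  define S where "S = {x. \<forall>b\<in>B. b \<bullet> x = 0}"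
  have sub: "subspace S"
    by (auto simp: S_def subspace_def inner_add_right)
  \<comment> \<open>By symmetry, for \<open>b\<close> in \<open>B\<close> with eigenvalue c, the
    product of \<open>b\<close> with \<open>A *v x\<close> is c times that of \<open>b\<close> with
    \<open>x\<close>, hence 0.\<close>
  have inv: "A *v x \<in> S" if "x \<in> S" for x
    using that ev by (fastforce simp: S_def symmetric_inner_commute[OF sym])
  have "dim (span B) \<le> k" using dim_le_card[OF span_superset, of B] B by (simp add: dim_span)
  then have "dim B < DIM(real^'n)" using Suc.prems by (simp add: dim_span)
  then obtain x where x: "x \<noteq> 0" "\<And>y. y \<in> span B \<Longrightarrow> orthogonal x y"
    using orthogonal_to_subspace_exists by blast
  then have "x \<in> S"
    by (auto simp: S_def orthogonal_def inner_commute span_base)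
  with x have "S \<noteq> {0}" by auto
  then obtain v c where v: "v \<in> S" "norm v = 1" "A *v v = c *\<^sub>R v"
    using symmetric_eigenvector_exists[OF sym sub _ inv] by blast
  have "v \<notin> B" using v by (auto simp: S_def norm_eq_1)
  moreover have "pairwise orthogonal (insert v B)"
    using B v by (auto simp: pairwise_insert S_def orthogonal_def inner_commute)
  ultimately show ?case using B v ev by (intro exI[of _ "insert v B"]) auto
qed

definition diagonal_matrix :: "('n \<Rightarrow> real) \<Rightarrow> real^'n^'n" where
  "diagonal_matrix d = (\<chi> i j. if i = j then d i else 0)"

lemma matrix_mult_diagonal_matrix:
  fixes A :: "real^'n^'m"
  shows "(A ** diagonal_matrix d) $ i $ j = A $ i $ j * d j"
  by (simp add: matrix_matrix_mult_def diagonal_matrix_def if_distrib cong: if_cong)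

lemma diagonal_matrix_mult:
  "diagonal_matrix (c :: 'n::finite \<Rightarrow> real) ** diagonal_matrix d = diagonal_matrix (\<lambda>i. c i * d i)"
  by (simp add: vec_eq_iff matrix_mult_diagonal_matrix) (simp add: diagonal_matrix_def)

lemma transpose_diagonal_matrix [simp]: "transpose (diagonal_matrix d) = diagonal_matrix d"
  by (auto simp: vec_eq_iff transpose_def diagonal_matrix_def)

lemma diagonal_matrix_mult_vec: "(diagonal_matrix d *v x) $ i = d i * x $ i"
  by (simp add: matrix_vector_mult_def diagonal_matrix_def if_distrib if_distribR cong: if_cong)

text \<open>An orthonormal eigenbasis has as many members as the index type, so a bijection from the
  indices arranges it as the columns of \<open>Q\<close>. No order of the eigenvalues is
  fixed.\<close>

theorem symmetric_diagonalizable: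
  fixes A :: "real^'n^'n"
  assumes sym: "transpose A = A"
  obtains Q d where "orthogonal_matrix Q" "A = Q ** diagonal_matrix d ** transpose Q"
proof -
  obtain B where B: "finite B" "card B = CARD('n)" "pairwise orthogonal B"
    and ev: "\<And>b. b \<in> B \<Longrightarrow> norm b = 1 \<and> (\<exists>c. A *v b = c *\<^sub>R b)"
    using symmetric_orthonormal_eigenvectors[OF sym order_refl] by blast
  obtain q where q: "bij_betw q (UNIV :: 'n set) B"
    using B finite_same_card_bij[of "UNIV :: 'n set" B] by auto
  then have qB: "q i \<in> B" for i by (auto simp: bij_betw_def)
  have "\<forall>i. \<exists>c. A *v q i = c *\<^sub>R q i" using ev qB by blast
  then obtain d where d: "\<And>i. A *v q i = d i *\<^sub>R q i" unfolding choice_iff by blast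
  define Q :: "real^'n^'n" where "Q = (\<chi> i j. q j $ i)"
  have col: "column j Q = q j" for j by (simp add: Q_def column_def vec_eq_iff)
  have oQ: "orthogonal_matrix Q"
    unfolding orthogonal_matrix_orthonormal_columns col
    using ev qB pairwiseD[OF B(3) qB qB] bij_betw_imp_inj_on[OF q] by (metis injD)
  have "(A ** Q) $ i $ j = (Q ** diagonal_matrix d) $ i $ j" for i j
  proof -
    have "(A ** Q) $ i $ j = (A *v q j) $ i"
      by (simp add: matrix_matrix_mult_def matrix_vector_mult_def Q_def)
    then show ?thesis by (simp add: d matrix_mult_diagonal_matrix Q_def)
  qed
  then have "A ** Q = Q ** diagonal_matrix d" by (simp add: vec_eq_iff)
  then have "A = Q ** diagonal_matrix d ** transpose Q"
    by (metis matrix_mul_assoc matrix_mul_rid oQ orthogonal_matrix_def)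
  with oQ show thesis by (rule that)
qed

section \<open>Calculus of a diagonalized matrix\<close>

text \<open>Evaluation at \<open>x\<close> is a ring homomorphism, so it passes through the Leibniz
  expansion of the determinant.\<close>

lemma poly_charpoly: "poly (charpoly A) x = det (diagonal_matrix (\<lambda>_. x) - A)"
proof -
  have "poly ((if i = j then [:0, 1:] else 0) - [:A $ i $ j:]) x
      = (diagonal_matrix (\<lambda>_. x) - A) $ i $ j" for i j
    by (simp add: diagonal_matrix_def)
  then show ?thesis
    by (simp only: charpoly_def det_def poly_sum poly_prod poly_mult poly_of_int vec_lambda_beta)
qed

locale orthogonal_diagonalization =
  fixes A Q :: "real^'n^'n" and d :: "'n \<Rightarrow> real"
  assumes orthogonal: "orthogonal_matrix Q"
    and decomp: "A = Q ** diagonal_matrix d ** transpose Q"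
begin

lemma Q_cancel: "transpose Q ** Q = mat 1" "Q ** transpose Q = mat 1"
  using orthogonal by (auto simp: orthogonal_matrix_def)

text \<open>Functional calculus: \<open>conj_diag (\<lambda>i. f (d i))\<close> is f(A), and
  \<open>A\<close> itself is \<open>conj_diag d\<close>.\<close>

definition conj_diag :: "('n \<Rightarrow> real) \<Rightarrow> real^'n^'n" where
  "conj_diag c = Q ** diagonal_matrix c ** transpose Q"

lemma conj_diag_mult: "conj_diag b ** conj_diag c = conj_diag (\<lambda>i. b i * c i)"
proof -
  have "conj_diag b ** conj_diag c
      = Q ** diagonal_matrix b ** (transpose Q ** Q) ** diagonal_matrix c ** transpose Q"
    by (simp add: conj_diag_def matrix_mul_assoc)
  also have "\<dots> = Q ** (diagonal_matrix b ** diagonal_matrix c) ** transpose Q"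
    by (simp add: Q_cancel matrix_mul_assoc)
  finally show ?thesis by (simp add: diagonal_matrix_mult conj_diag_def)
qed

lemma transpose_conj_diag [simp]: "transpose (conj_diag c) = conj_diag c"
  by (simp add: conj_diag_def matrix_transpose_mul matrix_mul_assoc)

lemma trace_conj_diag: "trace (conj_diag c) = sum c UNIV"
proof -
  have "trace (conj_diag c) = trace (transpose Q ** (Q ** diagonal_matrix c))"
    unfolding conj_diag_def by (rule trace_mul_sym)
  also have "\<dots> = trace (diagonal_matrix c)"
    by (simp add: matrix_mul_assoc Q_cancel)
  finally show ?thesis by (simp add: trace_def diagonal_matrix_def)
qed

lemma det_conj_diag: "det (conj_diag c) = prod c UNIV"
proof -
  have "det (conj_diag c) = det (diagonal_matrix c) * det (Q ** transpose Q)"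
    by (simp add: conj_diag_def det_mul)
  then show ?thesis
    by (simp add: Q_cancel) (simp add: det_diagonal diagonal_matrix_def)
qed

lemma conj_diag_const: "conj_diag (\<lambda>_. x) = diagonal_matrix (\<lambda>_. x)"
proof -
  have "diagonal_matrix (\<lambda>_. x) = x *\<^sub>R (mat 1 :: real^'n^'n)"
    by (simp add: vec_eq_iff diagonal_matrix_def mat_def)
  then show ?thesis
    by (simp add: conj_diag_def matrix_scalar_ac Q_cancel flip: scalar_matrix_assoc)
qed

lemma conj_diag_add: "conj_diag b + conj_diag c = conj_diag (\<lambda>i. b i + c i)"
proof -
  have "conj_diag e $ i $ j = (\<Sum>k\<in>UNIV. Q $ i $ k * e k * Q $ j $ k)" for e i j
    unfolding conj_diag_def by (subst matrix_matrix_mult_def)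
      (simp add: matrix_mult_diagonal_matrix transpose_def)
  then show ?thesis by (simp add: vec_eq_iff algebra_simps sum.distrib)
qed

lemma charpoly_eq: "charpoly A = (\<Prod>i\<in>UNIV. [:- d i, 1:])"
proof (rule poly_ext)
  fix x
  have "diagonal_matrix (\<lambda>_. x) - A = conj_diag (\<lambda>i. x - d i)"
    using conj_diag_add[of "\<lambda>i. x - d i" d] decomp by (simp add: conj_diag_const conj_diag_def[of d] algebra_simps)
  then show "poly (charpoly A) x = poly (\<Prod>i\<in>UNIV. [:- d i, 1:]) x"
    by (simp add: poly_charpoly det_conj_diag poly_prod)
qed

text \<open>The link from the unordered family \<open>d\<close> to the sorted \<lambda>_1, ...,
  \<lambda>_n: each linear factor of the characteristic polynomial contributes one root, so
  multiplicities agree.\<close>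

lemma eigenvalue_list_eq:
  "eigenvalue_list A = sorted_list_of_multiset (image_mset d (mset_set UNIV))"
proof -
  have "proots (charpoly A) = (\<Sum>i\<in>UNIV. {#d i#})"
    by (simp add: charpoly_eq proots_prod)
  also have "\<dots> = image_mset d (mset_set UNIV)"
    by (simp add: sum_unfold_sum_mset)
  finally show ?thesis by (simp add: eigenvalue_list_def)
qed

text \<open>\<open>Q *v axis i 1\<close> is column \<open>i\<close> of \<open>Q\<close>; in this
  form the claim follows from associativity alone.\<close>

lemma eigenvector_column: "A *v (Q *v axis i 1) = d i *\<^sub>R (Q *v axis i 1)"
proof -
  have "A ** Q = Q ** diagonal_matrix d"
    by (metis Q_cancel(1) decomp matrix_mul_assoc matrix_mul_rid)
  moreover have "diagonal_matrix d *v axis i 1 = d i *\<^sub>R axis i 1"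
    by (simp add: vec_eq_iff diagonal_matrix_mult_vec axis_def)
  ultimately show ?thesis
    by (metis matrix_vector_mul_assoc matrix_vector_mult_scaleR)
qed

lemma inner_columns: "(Q *v axis i 1) \<bullet> (Q *v axis j 1) = (if i = j then 1 else 0)"
proof -
  have "(Q *v axis i 1) \<bullet> (Q *v axis j 1) = axis i 1 \<bullet> (transpose Q *v (Q *v axis j 1))"
    using dot_lmul_matrix[of "axis i 1" "transpose Q"] by simp
  then show ?thesis by (simp add: matrix_vector_mul_assoc Q_cancel inner_axis_axis)
qed

end

section \<open>The Moore-Penrose inverse\<close>

text \<open>\<open>A ** X\<close> and \<open>A ** Y\<close> are both the orthogonal projection onto
  the range of \<open>A\<close>, and \<open>X ** A\<close> and \<open>Y ** A\<close> both that onto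
  the complement of its kernel. Once these agree, X = XAX = YAY = Y.\<close>

lemma moore_penrose_inverse_unique:
  fixes A :: "real^'n^'m"
  assumes X: "is_moore_penrose_inverse A X" and Y: "is_moore_penrose_inverse A Y"
  shows "X = Y"
proof -
  note x = X[unfolded is_moore_penrose_inverse_def]
  note y = Y[unfolded is_moore_penrose_inverse_def]
  have "A ** X = A ** Y ** (A ** X)"
    using y by (simp add: matrix_mul_assoc)
  also have "\<dots> = transpose (A ** Y) ** transpose (A ** X)" using x y by simp
  also have "\<dots> = transpose (A ** X ** A ** Y)"
    by (simp add: matrix_transpose_mul matrix_mul_assoc)
  also have "\<dots> = A ** Y" using x y by simp
  finally have AX: "A ** X = A ** Y" .
  have "X ** A = X ** A ** (Y ** A)"
    using y by (metis matrix_mul_assoc)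
  also have "\<dots> = transpose (X ** A) ** transpose (Y ** A)" using x y by simp
  also have "\<dots> = transpose (Y ** (A ** X ** A))"
    by (simp add: matrix_transpose_mul matrix_mul_assoc)
  also have "\<dots> = Y ** A" using x y by simp
  finally have XA: "X ** A = Y ** A" .
  have "X = X ** A ** X" using x by simp
  also have "\<dots> = Y ** A ** Y" by (metis AX XA matrix_mul_assoc)
  finally show ?thesis using y by simp
qed

lemma moore_penrose_inverse_eqI:
  "is_moore_penrose_inverse A X \<Longrightarrow> moore_penrose_inverse A = X"
  unfolding moore_penrose_inverse_def by (blast intro: moore_penrose_inverse_unique)

text \<open>Because \<open>inverse 0 = 0\<close>, the Penrose identities hold at zero eigenvalues
  too.\<close>

lemma (in orthogonal_diagonalization) moore_penrose_inverse_eq: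
  "moore_penrose_inverse A = conj_diag (\<lambda>i. inverse (d i))"
proof (rule moore_penrose_inverse_eqI)
  have *: "x * inverse x * x = x" "inverse x * x * inverse x = inverse x" for x :: real
    by (cases "x = 0"; simp)+
  have "A = conj_diag d" by (simp add: conj_diag_def decomp)
  then show "is_moore_penrose_inverse A (conj_diag (\<lambda>i. inverse (d i)))"
    by (simp add: is_moore_penrose_inverse_def conj_diag_mult *)
qed

section \<open>Kantorovich's inequality and extreme entries of a sorted list\<close>

text \<open>Dividing \<open>(a i - p) * (P - a i) \<ge> 0\<close> by \<open>a i\<close> gives a
  bound linear in \<open>a i\<close> and its inverse. Sum it over \<open>I\<close> and apply 4xy
  \<le> (x + y)^2, with x the sum of the \<open>a i\<close> and y that of the inverses times
  \<open>p * P\<close>.\<close>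

lemma Kantorovich_inequality:
  fixes a :: "'a \<Rightarrow> real"
  assumes p: "0 < p" and a: "\<And>i. i \<in> I \<Longrightarrow> p \<le> a i \<and> a i \<le> P"
  shows "4 * p * P * (\<Sum>i\<in>I. a i) * (\<Sum>i\<in>I. inverse (a i)) \<le> (real (card I) * (p + P))\<^sup>2"
proof (cases "I = {}")
  case False
  then have P: "0 < P" using p a by force
  have "a i + p * P * inverse (a i) \<le> p + P" if "i \<in> I" for i
  proof -
    have "0 < a i" using p a[OF that] by linarith
    moreover have "0 \<le> (a i - p) * (P - a i)" using a[OF that] by simp
    ultimately show ?thesis by (simp add: field_simps)
  qed
  then have le: "(\<Sum>i\<in>I. a i) + p * P * (\<Sum>i\<in>I. inverse (a i)) \<le> card I * (p + P)"
    using sum_mono[of I "\<lambda>i. a i + p * P * inverse (a i)" "\<lambda>_. p + P"]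
    by (simp add: sum.distrib sum_distrib_left)
  have pos: "0 \<le> a i" if "i \<in> I" for i using p a[OF that] by linarith
  have "4 * p * P * (\<Sum>i\<in>I. a i) * (\<Sum>i\<in>I. inverse (a i))
      \<le> ((\<Sum>i\<in>I. a i) + p * P * (\<Sum>i\<in>I. inverse (a i)))\<^sup>2"
    using sum_squares_ge_zero[of "(\<Sum>i\<in>I. a i) - p * P * (\<Sum>i\<in>I. inverse (a i))" 0]
    by (simp add: power2_eq_square algebra_simps)
  also have "\<dots> \<le> (card I * (p + P))\<^sup>2"
    using le p P pos by (intro power_mono) (auto intro!: add_nonneg_nonneg mult_nonneg_nonneg sum_nonneg)
  finally show ?thesis .
qed simp

text \<open>Sorting puts the minimum \<open>d i\<^sub>0\<close> first, and the tail sorts the values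
  at the other indices. Counting from 0, entry 1 is their least value and the last entry their
  greatest; \<open>i\<close> witnesses that the tail is nonempty.\<close>

lemma sorted_list_of_multiset_image_minimum:
  fixes d :: "'a::finite \<Rightarrow> 'b::linorder"
  assumes min: "\<And>i. d i\<^sub>0 \<le> d i" and i: "i \<noteq> i\<^sub>0"
  defines "xs \<equiv> sorted_list_of_multiset (image_mset d (mset_set UNIV))"
  shows "xs ! 1 \<in> d ` (UNIV - {i\<^sub>0})" "xs ! 1 \<le> d i" "d i \<le> xs ! (CARD('a) - 1)"
proof -
  define ys where "ys = sorted_list_of_multiset (image_mset d (mset_set (UNIV - {i\<^sub>0})))"
  have set: "set ys = d ` (UNIV - {i\<^sub>0})" by (simp add: ys_def)
  have len: "length ys = CARD('a) - 1"
    by (simp add: ys_def card_Diff_singleton flip: size_mset)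
  have "mset_set UNIV = add_mset i\<^sub>0 (mset_set (UNIV - {i\<^sub>0}))"
    by (simp add: mset_set.remove)
  then have xs: "xs = d i\<^sub>0 # ys"
    using min by (simp add: xs_def insort_is_Cons flip: ys_def) (simp add: insort_is_Cons set)
  have sorted: "sorted ys" by (simp add: ys_def)
  obtain k where k: "k < length ys" "ys ! k = d i"
    using i set by (metis DiffI UNIV_I imageI in_set_conv_nth singletonD)
  have "ys ! 0 \<in> set ys" using k by (intro nth_mem) linarith
  then show "xs ! 1 \<in> d ` (UNIV - {i\<^sub>0})" by (simp add: xs set)
  show "xs ! 1 \<le> d i" using sorted_nth_mono[OF sorted, of 0 k] k by (simp add: xs)
  have "xs ! (CARD('a) - 1) = ys ! (length ys - 1)" using k len by (cases "CARD('a) - 1") (simp_all add: xs)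
  then show "d i \<le> xs ! (CARD('a) - 1)"
    using sorted_nth_mono[OF sorted, of k "length ys - 1"] k by simp
qed

section \<open>The Laplacian of a connected graph\<close>

locale connected_graph = graph G for G :: "('v::finite, 'e) pre_digraph" +
  assumes verts: "verts G = UNIV"
    and connected: "Digraph_Component.connected G"
begin

lemma dominates_sym: "u \<rightarrow>\<^bsub>G\<^esub> v \<longleftrightarrow> v \<rightarrow>\<^bsub>G\<^esub> u"
  using arcs_ends_symmetric[OF sym_arcs] by blast

text \<open>Without multiple arcs, an arc out of \<open>u\<close> is determined by its head, so arcs
  out of \<open>u\<close> correspond to neighbours.\<close>

lemma out_degree_eq_sum: "real (out_degree G u) = (\<Sum>v\<in>UNIV. if u \<rightarrow>\<^bsub>G\<^esub> v then 1 else 0)"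
proof -
  have "inj_on (head G) (out_arcs G u)"
    using no_multi_arcs by (auto simp: inj_on_def arc_to_ends_def)
  then have "out_degree G u = card (head G ` out_arcs G u)"
    by (simp add: out_degree_def card_image)
  also have "head G ` out_arcs G u = {v. u \<rightarrow>\<^bsub>G\<^esub> v}"
    by (force simp: arcs_ends_conv)
  finally show ?thesis by (simp add: sum.If_cases)
qed

text \<open>Handshake lemma: count the arcs by endpoint pair, where each edge carries exactly an arc
  and its reverse, and then by tail.\<close>

lemma sum_out_degree: "(\<Sum>u\<in>UNIV. out_degree G u) = 2 * card (edge_set G)"
proof -
  have "card {a \<in> arcs G. {tail G a, head G a} = e} = 2" if e: "e \<in> edge_set G" for e
  proof -
    obtain a where a: "a \<in> arcs G" "e = {tail G a, head G a}"
      using e by (auto simp: edge_set_def)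
    obtain b where b: "b \<in> arcs G" "tail G b = head G a" "head G b = tail G a"
      using a sym_arcs unfolding symmetric_conv by metis
    have "{x \<in> arcs G. {tail G x, head G x} = e} = {a, b}"
      using a b no_multi_arcs by (auto simp: doubleton_eq_iff arc_to_ends_def)
    moreover have "a \<noteq> b" using no_loops a b by auto
    ultimately show ?thesis by simp
  qed
  then have "2 * card (edge_set G)
      = (\<Sum>e\<in>edge_set G. \<Sum>a\<in>{a \<in> arcs G. {tail G a, head G a} = e}. 1)"
    by simp
  also have "\<dots> = (\<Sum>a\<in>arcs G. 1)"
    by (rule sum.group) (auto simp: edge_set_def)
  also have "\<dots> = (\<Sum>u\<in>UNIV. \<Sum>a\<in>{a \<in> arcs G. tail G a = u}. 1)"
    by (rule sum.group[symmetric]) auto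
  finally show ?thesis by (simp add: out_degree_def out_arcs_def)
qed

lemma laplacian_entry:
  "laplacian G $ u $ v = (if u = v then real (out_degree G u) else 0) - (if u \<rightarrow>\<^bsub>G\<^esub> v then 1 else 0)"
  by (simp add: laplacian_def degree_matrix_def adjacency_matrix_def)

lemma transpose_laplacian: "transpose (laplacian G) = laplacian G"
  by (auto simp: vec_eq_iff transpose_def laplacian_entry dominates_sym)

lemma laplacian_mult_vec:
  "(laplacian G *v x) $ u = (\<Sum>v\<in>UNIV. if u \<rightarrow>\<^bsub>G\<^esub> v then x $ u - x $ v else 0)"
proof -
  have "(laplacian G *v x) $ u
      = real (out_degree G u) * x $ u - (\<Sum>v\<in>UNIV. if u \<rightarrow>\<^bsub>G\<^esub> v then x $ v else 0)"
    by (simp add: matrix_vector_mult_def laplacian_entry left_diff_distrib sum_subtractf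
        if_distribR if_distrib[of "\<lambda>z. z * _"] cong: if_cong)
  also have "\<dots> = (\<Sum>v\<in>UNIV. (if u \<rightarrow>\<^bsub>G\<^esub> v then 1 else 0) * x $ u - (if u \<rightarrow>\<^bsub>G\<^esub> v then x $ v else 0))"
    by (simp only: out_degree_eq_sum sum_subtractf sum_distrib_right)
  also have "\<dots> = (\<Sum>v\<in>UNIV. if u \<rightarrow>\<^bsub>G\<^esub> v then x $ u - x $ v else 0)"
    by (intro sum.cong) auto
  finally show ?thesis .
qed

lemma laplacian_mult_one: "laplacian G *v 1 = 0"
  by (simp add: vec_eq_iff laplacian_mult_vec cong: if_cong)

text \<open>Adding to the double sum its copy with \<open>u\<close> and \<open>v\<close> exchanged
  completes the square. The factor 2 stems from this doubling.\<close>

lemma laplacian_quadratic_form: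
  "2 * (x \<bullet> (laplacian G *v x))
    = (\<Sum>u\<in>UNIV. \<Sum>v\<in>UNIV. if u \<rightarrow>\<^bsub>G\<^esub> v then (x $ u - x $ v)\<^sup>2 else 0)"
proof -
  let ?f = "\<lambda>u v. if u \<rightarrow>\<^bsub>G\<^esub> v then x $ u * (x $ u - x $ v) else 0"
  have "x \<bullet> (laplacian G *v x) = (\<Sum>u\<in>UNIV. \<Sum>v\<in>UNIV. ?f u v)"
    unfolding inner_vec_def laplacian_mult_vec
    by (auto simp: sum_distrib_left intro!: sum.cong)
  moreover have "(\<Sum>u\<in>UNIV. \<Sum>v\<in>UNIV. ?f u v) = (\<Sum>u\<in>UNIV. \<Sum>v\<in>UNIV. ?f v u)"
    by (rule sum.swap)
  ultimately have "2 * (x \<bullet> (laplacian G *v x)) = (\<Sum>u\<in>UNIV. \<Sum>v\<in>UNIV. ?f u v + ?f v u)"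
    by (simp only: sum.distrib)
  also have "\<dots> = (\<Sum>u\<in>UNIV. \<Sum>v\<in>UNIV. if u \<rightarrow>\<^bsub>G\<^esub> v then (x $ u - x $ v)\<^sup>2 else 0)"
    by (intro sum.cong refl) (auto simp: dominates_sym power2_eq_square algebra_simps)
  finally show ?thesis .
qed

text \<open>The quadratic form vanishes at \<open>x\<close>, hence so does each of its nonnegative
  terms; thus \<open>x\<close> is constant along arcs, and along paths by connectedness.\<close>

lemma laplacian_kernel_const:
  assumes "laplacian G *v x = 0"
  shows "x $ u = x $ v"
proof -
  have eq: "x $ u = x $ v" if "u \<rightarrow>\<^bsub>G\<^esub> v" for u v
  proof -
    have "(\<Sum>u\<in>UNIV. \<Sum>v\<in>UNIV. if u \<rightarrow>\<^bsub>G\<^esub> v then (x $ u - x $ v)\<^sup>2 else 0) = 0"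
      using laplacian_quadratic_form[of x] assms by simp
    then have "(if u \<rightarrow>\<^bsub>G\<^esub> v then (x $ u - x $ v)\<^sup>2 else 0) = 0"
      by (simp add: sum_nonneg_eq_0_iff sum_nonneg)
    then show ?thesis using that by simp
  qed
  have "u \<rightarrow>\<^sup>*\<^bsub>G\<^esub> v"
    using symmetric_connected_imp_strongly_connected[OF sym_arcs connected] verts
    by (auto simp: strongly_connected_def)
  then show ?thesis by (induction rule: reachable_induct) (simp_all add: eq)
qed

text \<open>The diagonal entries contribute the squared degrees and each arc contributes 1. Without
  loops the two kinds of entry never overlap.\<close>

lemma trace_laplacian_squared:
  "trace (laplacian G ** laplacian G)
    = 2 * real (card (edge_set G)) + real (first_zagreb_index G)"
proof -
  have [simp]: "\<not> u \<rightarrow>\<^bsub>G\<^esub> u" for u using adj_not_same by blast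
  have "trace (laplacian G ** laplacian G)
      = (\<Sum>u\<in>UNIV. \<Sum>v\<in>UNIV. laplacian G $ u $ v * laplacian G $ v $ u)"
    by (simp add: trace_def matrix_matrix_mult_def)
  also have "\<dots> = (\<Sum>u\<in>UNIV. \<Sum>v\<in>UNIV.
      (if u = v then (real (out_degree G u))\<^sup>2 else 0) + (if u \<rightarrow>\<^bsub>G\<^esub> v then 1 else 0))"
    by (intro sum.cong refl) (auto simp: laplacian_entry dominates_sym power2_eq_square)
  also have "\<dots> = (\<Sum>u\<in>UNIV. (real (out_degree G u))\<^sup>2) + (\<Sum>u\<in>UNIV. real (out_degree G u))"
    by (simp add: sum.distrib out_degree_eq_sum)
  also have "\<dots> = real (first_zagreb_index G) + real (2 * card (edge_set G))"
    by (simp add: first_zagreb_index_def verts flip: sum_out_degree)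
  finally show ?thesis by simp
qed

end

section \<open>The Laplacian spectrum and the biharmonic index\<close>

locale diagonalized_laplacian = connected_graph G + orthogonal_diagonalization "laplacian G" Q d
  for G :: "('v::finite, 'e) pre_digraph" and Q d
begin

text \<open>A zero eigenvalue contributes \<open>inverse 0 = 0\<close>, so the sum may run over all
  indices.\<close>

lemma biharmonic_index_eq: "biharmonic_index G = real CARD('v) * (\<Sum>i\<in>UNIV. inverse ((d i)\<^sup>2))"
proof -
  define X where "X = conj_diag (\<lambda>i. inverse (d i))"
  define B where "B = X ** X"
  \<comment> \<open>A factor \<open>laplacian G\<close> on the right shows that \<open>X\<close>,
    and then \<open>B\<close>, annihilates the constant vectors.\<close>
  have "X = B ** laplacian G"
  proof -
    have "inverse x * inverse x * x = inverse x" for x :: real by (cases "x = 0") auto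
    then have "X = conj_diag (\<lambda>i. inverse (d i)) ** conj_diag (\<lambda>i. inverse (d i)) ** conj_diag d"
      by (simp only: X_def conj_diag_mult)
    then show ?thesis using decomp by (simp add: B_def X_def conj_diag_def[of d])
  qed
  then have "X *v 1 = 0"
    by (metis laplacian_mult_one matrix_vector_mul_assoc matrix_vector_mult_0_right)
  then have "B *v 1 = 0"
    by (metis B_def matrix_vector_mul_assoc matrix_vector_mult_0_right)
  then have row: "(\<Sum>v\<in>UNIV. B $ u $ v) = 0" for u
    by (simp add: vec_eq_iff matrix_vector_mult_def)
  have tr: "(\<Sum>v\<in>UNIV. B $ v $ v) = (\<Sum>i\<in>UNIV. inverse ((d i)\<^sup>2))"
    using trace_conj_diag by (simp add: trace_def B_def X_def conj_diag_mult power2_eq_square)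
  have "biharmonic_index G = (\<Sum>u\<in>UNIV. \<Sum>v\<in>UNIV. B $ u $ u + B $ v $ v - 2 * B $ u $ v) / 2"
    by (simp add: biharmonic_index_def biharmonic_dist_sq_def moore_penrose_inverse_eq verts
        B_def X_def Let_def)
  \<comment> \<open>The rows of \<open>B\<close> sum to 0, so the mixed terms vanish; each diagonal
    term yields n times the trace, and the 2 cancels.\<close>
  also have "\<dots> = real CARD('v) * (\<Sum>v\<in>UNIV. B $ v $ v)"
    by (simp add: sum.distrib sum_subtractf row flip: sum_distrib_left)
  finally show ?thesis by (simp add: tr)
qed

lemma sum_eigenvalues_squared:
  "(\<Sum>i\<in>UNIV. (d i)\<^sup>2) = 2 * real (card (edge_set G)) + real (first_zagreb_index G)"
proof -
  have "laplacian G = conj_diag d" by (simp add: conj_diag_def decomp)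
  then show ?thesis
    using trace_conj_diag[of "\<lambda>i. d i * d i"] trace_laplacian_squared
    by (simp add: conj_diag_mult power2_eq_square)
qed

lemma eigenvalue_nonneg: "0 \<le> d i"
proof -
  let ?q = "Q *v axis i 1"
  have "d i = ?q \<bullet> (laplacian G *v ?q)"
    by (simp add: eigenvector_column inner_columns)
  moreover have "0 \<le> 2 * (?q \<bullet> (laplacian G *v ?q))"
    unfolding laplacian_quadratic_form by (intro sum_nonneg) auto
  ultimately show ?thesis by simp
qed

text \<open>The constant vector makes the determinant, the product of the \<open>d i\<close>,
  vanish. Two zero eigenvalues would give two orthonormal columns that are both constant, which is
  impossible.\<close>

lemma eigenvalue_zero_ex1: "\<exists>!i. d i = 0"
proof -
  have "\<exists>i. d i = 0"
  proof (rule ccontr)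
    assume "\<nexists>i. d i = 0"
    then have "det (laplacian G) \<noteq> 0"
      using det_conj_diag[of d] decomp by (simp add: conj_diag_def)
    then have "invertible (laplacian G)" by (simp add: invertible_det_nz)
    then have "(1 :: real^'v) = 0"
      using laplacian_mult_one by (metis invertible_def matrix_vector_mul_assoc
          matrix_vector_mul_lid matrix_vector_mult_0_right)
    then show False by simp
  qed
  moreover have "i = j" if "d i = 0" "d j = 0" for i j
  proof (rule ccontr)
    assume "i \<noteq> j"
    let ?p = "Q *v axis i 1" and ?q = "Q *v axis j 1"
    have "laplacian G *v ?p = 0" "laplacian G *v ?q = 0"
      using that by (simp_all add: eigenvector_column)
    then obtain a b where ab: "\<And>u. ?p $ u = a" "\<And>u. ?q $ u = b"
      using laplacian_kernel_const by metis
    have "?p \<bullet> ?q = 0" "?p \<bullet> ?p = 1" "?q \<bullet> ?q = 1"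
      using \<open>i \<noteq> j\<close> by (simp_all add: inner_columns)
    then show False by (auto simp: inner_vec_def ab)
  qed
  ultimately show ?thesis by blast
qed

lemma biharmonic_index_le:
  defines "n \<equiv> real CARD('v)"
    and "T \<equiv> 2 * real (card (edge_set G)) + real (first_zagreb_index G)"
    and "r \<equiv> laplacian_spectral_ratio G"
  shows "biharmonic_index G \<le> n * (n - 1)\<^sup>2 / (4 * T) * (4 + (r - 1 / r)\<^sup>2)"
proof -
  obtain i\<^sub>0 where i0: "d i\<^sub>0 = 0" and unique: "\<And>i. d i = 0 \<Longrightarrow> i = i\<^sub>0"
    using eigenvalue_zero_ex1 by blast
  define I where "I = UNIV - {i\<^sub>0}"
  define S where "S = (\<Sum>i\<in>I. inverse ((d i)\<^sup>2))"
  have BH: "biharmonic_index G = n * S"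
    using i0 by (simp add: biharmonic_index_eq n_def S_def I_def sum.remove[of UNIV i\<^sub>0])
  have T: "T = (\<Sum>i\<in>I. (d i)\<^sup>2)"
    using i0 sum_eigenvalues_squared by (simp add: T_def I_def sum.remove[of UNIV i\<^sub>0])
  have card: "real (card I) = n - 1"
    by (simp add: I_def n_def card_Diff_singleton of_nat_diff Suc_leI)
  show ?thesis
  proof (cases "I = {}")
    \<comment> \<open>A single vertex: both sums are empty, and the right-hand side is 0 whatever
      the value of \<open>r\<close>, since division by \<open>4 * T\<close> = 0 yields 0.\<close>
    case True
    then show ?thesis by (simp add: BH S_def T)
  next
    case False
    then obtain j where j: "j \<in> I" by blast
    define a b where "a = laplacian_eigenvalue G 2" and "b = laplacian_eigenvalue G CARD('v)"
    have r: "r = b / a"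
      by (simp add: r_def laplacian_spectral_ratio_def a_def b_def verts)
    have min: "d i\<^sub>0 \<le> d i" for i using eigenvalue_nonneg i0 by simp
    \<comment> \<open>With the zero eigenvalue as head of the sorted list, \<lambda>_2 and
      \<lambda>_n are the least and the greatest eigenvalue over \<open>I\<close>.\<close>
    have ab: "a \<in> d ` I" "\<And>i. i \<in> I \<Longrightarrow> a \<le> d i" "\<And>i. i \<in> I \<Longrightarrow> d i \<le> b"
      using sorted_list_of_multiset_image_minimum[of d i\<^sub>0, OF min] j
      by (auto simp: a_def b_def laplacian_eigenvalue_def eigenvalue_list_eq I_def)
    have pos: "0 < d i" if "i \<in> I" for i
      using that unique eigenvalue_nonneg[of i] by (force simp: I_def less_le)
    have a: "0 < a" using ab pos by auto
    have b: "0 < b" using a ab(2,3) j by force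
    have "0 < T"
      unfolding T using j by (intro sum_pos) (auto simp: I_def dest: unique)
    \<comment> \<open>Kantorovich for the squared eigenvalues, with bounds \<open>a\<^sup>2\<close>
      and \<open>b\<^sup>2\<close>.\<close>
    have "4 * a\<^sup>2 * b\<^sup>2 * T * S \<le> ((n - 1) * (a\<^sup>2 + b\<^sup>2))\<^sup>2"
      unfolding T S_def card[symmetric]
    proof (rule Kantorovich_inequality)
      fix i assume "i \<in> I"
      then show "a\<^sup>2 \<le> (d i)\<^sup>2 \<and> (d i)\<^sup>2 \<le> b\<^sup>2"
        using ab(2,3)[of i] a by (simp add: power_mono)
    qed (use a in simp)
    \<comment> \<open>Both sides are (r + 1/r)^2 for r = b/a, so dividing the previous bound by
      \<open>4 * a\<^sup>2 * b\<^sup>2 * T\<close> gives the claim for \<open>S\<close>.\<close>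
    moreover have "4 + (r - 1 / r)\<^sup>2 = (a\<^sup>2 + b\<^sup>2)\<^sup>2 / (a\<^sup>2 * b\<^sup>2)"
      using a b by (simp add: r field_simps power2_eq_square)
    ultimately have "S \<le> (n - 1)\<^sup>2 / (4 * T) * (4 + (r - 1 / r)\<^sup>2)"
      using a b \<open>0 < T\<close> by (simp add: pos_le_divide_eq power_mult_distrib mult_ac)
    then have "n * S \<le> n * ((n - 1)\<^sup>2 / (4 * T) * (4 + (r - 1 / r)\<^sup>2))"
      by (rule mult_left_mono) (simp add: n_def)
    then show ?thesis by (simp add: BH)
  qed
qed

end

theorem theorem3p2:
  fixes G :: "('v::finite, 'e) pre_digraph" and n m :: nat
  assumes "graph G" and "verts G = UNIV"
    and "Digraph_Component.connected G"
    and "card (verts G) = n" and "card (edge_set G) = m"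
  shows "biharmonic_index G
    \<le> real n * (real n - 1)\<^sup>2 / (4 * (2 * real m + real (first_zagreb_index G)))
       * (4 + (laplacian_spectral_ratio G - 1 / laplacian_spectral_ratio G)\<^sup>2)"
proof -
  interpret connected_graph G
    using assms by (simp add: connected_graph_def connected_graph_axioms_def)
  obtain Q d where "orthogonal_matrix Q" "laplacian G = Q ** diagonal_matrix d ** transpose Q"
    using symmetric_diagonalizable[OF transpose_laplacian] .
  then interpret diagonalized_laplacian G Q d
    by unfold_locales
  show ?thesis using biharmonic_index_le assms by auto
qed

end
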